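(* Let $d\geq n$ be positive integers, let $H_1,\ldots,H_q\subseteq[d]$ and positive integers $r_1,\ldots,r_q$ satisfy $|H_i\cap H_j|\leq r_i+r_j-n$ for all $i\neq j$, and $|[d]\setminus H_i|\geq n-r_i$, $r_i\leq n-1$, $|H_i|\geq r_i+1$ for all $i$. Let $M$ be the elementary split matroid of $\mathcal{H}=\{H_1,\ldots,H_q\}$. Then $$\dim_{\mathrm{naive}}(\Gamma_M)=nd-\mathrm{ec}(M)=nd-\sum_{i=1}^q(n-r_i)(|H_i|-r_i).$$
   Context: The elementary split matroid of $\mathcal{H}$ is the rank-$n$ matroid on $[d]$ with independent sets $\{X\subseteq[d]:|X|\leq n,\ |X\cap H_i|\leq r_i\ \forall i\}$. Subspaces of a rank-$n$ matroid: circuits of size at most $n$ are grouped by $C_1\sim C_2\iff\mathrm{cl}(C_1)=\mathrm{cl}(C_2)$; each class $l$ is a subspace, $\mathrm{rank}(l)$ the rank of its circuits, $l$ identified with the set of points lying in some circuit of the class, $|l|$ its cardinality; $\mathcal{L}_M$ the set of subspaces. Naive dimension: $\dim_{\mathrm{naive}}(\Gamma_M)=nd-\sum_{l\in\mathcal{L}_M}(|l|-\mathrm{rank}(l))(n-\mathrm{rank}(l))$. Expected codimension: for $S\subseteq[d]$ let $c(S)=|S|-\mathrm{rank}(S)$; for a family $\mathcal{G}$ of subsets define $a_{\mathcal{G}}(\emptyset)=0$, $a_{\mathcal{G}}(S)=c(S)-\sum_{T\in\mathcal{G},T\subsetneq S}a_{\mathcal{G}}(T)$, $\mathrm{ec}_{\mathcal{G}}(M)=\sum_{S\in\mathcal{G}}(n-\mathrm{rank}(S))a_{\mathcal{G}}(S)$,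 and $\mathrm{ec}(M)=\mathrm{ec}_{\mathcal{G}}(M)$ for $\mathcal{G}$ the family of all subsets of $[d]$. *)

theory Defs
  imports Main
begin

record 'a matroid_data =
  ground :: "'a set"
  indeps :: "'a set set"

definition is_matroid :: "'a matroid_data \<Rightarrow> bool" where
  "is_matroid M \<longleftrightarrow>
     finite (ground M) \<and>
     indeps M \<subseteq> Pow (ground M) \<and>
     {} \<in> indeps M \<and>
     (\<forall>X\<in>indeps M. \<forall>Y. Y \<subseteq> X \<longrightarrow> Y \<in> indeps M) \<and>
     (\<forall>X\<in>indeps M. \<forall>Y\<in>indeps M. card X < card Y \<longrightarrow> (\<exists>e\<in>Y - X. insert e X \<in> indeps M))"

definition rank_of :: "'a matroid_data \<Rightarrow> 'a set \<Rightarrow> nat" where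
  "rank_of M S = Max (card ` {X \<in> indeps M. X \<subseteq> S})"

definition matroid_rank :: "'a matroid_data \<Rightarrow> nat" where
  "matroid_rank M = rank_of M (ground M)"

definition cl :: "'a matroid_data \<Rightarrow> 'a set \<Rightarrow> 'a set" where
  "cl M S = {e \<in> ground M. rank_of M (insert e S) = rank_of M S}"

definition circuits :: "'a matroid_data \<Rightarrow> 'a set set" where
  "circuits M = {C. C \<subseteq> ground M \<and> C \<notin> indeps M \<and> (\<forall>D. D \<subset> C \<longrightarrow> D \<in> indeps M)}"

definition small_circuits :: "'a matroid_data \<Rightarrow> 'a set set" where
  "small_circuits M = {C \<in> circuits M. card C \<le> matroid_rank M}"

definition circuit_rel :: "'a matroid_data \<Rightarrow> ('a set \<times> 'a set) set" where
  "circuit_rel M =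
     {(C1, C2). C1 \<in> small_circuits M \<and> C2 \<in> small_circuits M \<and> cl M C1 = cl M C2}"

text \<open>A subspace is an equivalence class of circuits.\<close>

definition subspaces :: "'a matroid_data \<Rightarrow> 'a set set set" where
  "subspaces M = small_circuits M // circuit_rel M"

definition subspace_points :: "'a set set \<Rightarrow> 'a set" where
  "subspace_points l = \<Union> l"

text \<open>Well defined for \<open>l\<close> in \<open>subspaces M\<close>, as circuits with the same closure have the same rank.\<close>

definition subspace_rank :: "'a matroid_data \<Rightarrow> 'a set set \<Rightarrow> nat" where
  "subspace_rank M l = (THE k. \<forall>C\<in>l. rank_of M C = k)"

definition naive_dim :: "'a matroid_data \<Rightarrow> int" where
  "naive_dim M =
     int (matroid_rank M) * int (card (ground M)) -
     (\<Sum>l\<in>subspaces M.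
        (int (card (subspace_points l)) - int (subspace_rank M l)) *
        (int (matroid_rank M) - int (subspace_rank M l)))"

definition nullity :: "'a matroid_data \<Rightarrow> 'a set \<Rightarrow> int" where
  "nullity M S = int (card S) - int (rank_of M S)"

text \<open>The finiteness guard only serves termination; the value on infinite sets is irrelevant.\<close>

function ec_coeff :: "'a matroid_data \<Rightarrow> 'a set set \<Rightarrow> 'a set \<Rightarrow> int" where
  "ec_coeff M G S =
     (if S = {} \<or> infinite S then 0
      else nullity M S - (\<Sum>T\<in>{T \<in> G. T \<subset> S}. ec_coeff M G T))"
  by auto
termination
  by (relation "measure (\<lambda>(M, G, S). card S)") (auto intro: psubset_card_mono)

declare ec_coeff.simps [simp del]

definition expected_codim_wrt :: "'a set set \<Rightarrow> 'a matroid_data \<Rightarrow> int" where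
  "expected_codim_wrt G M =
     (\<Sum>S\<in>G. (int (matroid_rank M) - int (rank_of M S)) * ec_coeff M G S)"

definition expected_codim :: "'a matroid_data \<Rightarrow> int" where
  "expected_codim M = expected_codim_wrt (Pow (ground M)) M"

definition elementary_split_matroid ::
    "nat \<Rightarrow> nat \<Rightarrow> nat \<Rightarrow> (nat \<Rightarrow> nat set) \<Rightarrow> (nat \<Rightarrow> nat) \<Rightarrow> nat matroid_data" where
  "elementary_split_matroid n d q H r =
     \<lparr>ground = {1..d},
      indeps = {X. X \<subseteq> {1..d} \<and> card X \<le> n \<and> (\<forall>i\<in>{1..q}. card (X \<inter> H i) \<le> r i)}\<rparr>"

lemma elementary_split_blocked:
  fixes n d q :: nat and H :: "nat \<Rightarrow> nat set" and r :: "nat \<Rightarrow> nat"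
  assumes H: "\<And>i. i \<in> {1..q} \<Longrightarrow> H i \<subseteq> {1..d}"
    and inter: "\<And>i j. \<lbrakk>i \<in> {1..q}; j \<in> {1..q}; i \<noteq> j\<rbrakk> \<Longrightarrow>
             int (card (H i \<inter> H j)) \<le> int (r i) + int (r j) - int n"
    and X: "X \<in> indeps (elementary_split_matroid n d q H r)"
    and less: "card X < n" and Y: "Y \<subseteq> {1..d} - X" "Y \<noteq> {}"
    and blocked: "\<And>e. e \<in> Y \<Longrightarrow> insert e X \<notin> indeps (elementary_split_matroid n d q H r)"
  shows "\<exists>i\<in>{1..q}. card (X \<inter> H i) = r i \<and> Y \<subseteq> H i"
proof -
  have Xd: "X \<subseteq> {1..d}" and Xr: "\<And>i. i \<in> {1..q} \<Longrightarrow> card (X \<inter> H i) \<le> r i"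
    using X by (auto simp: elementary_split_matroid_def)
  have fX: "finite X" using Xd finite_subset by blast
  have tight: "\<exists>i\<in>{1..q}. card (X \<inter> H i) = r i \<and> e \<in> H i" if e: "e \<in> Y" for e
  proof -
    have eX: "e \<in> {1..d}" "e \<notin> X" using e Y by auto
    then have "card (insert e X) \<le> n" using less fX by simp
    then obtain i where i: "i \<in> {1..q}" "\<not> card (insert e X \<inter> H i) \<le> r i"
      using blocked[OF e] eX Xd by (auto simp: elementary_split_matroid_def)
    have eH: "e \<in> H i"
    proof (rule ccontr)
      assume "e \<notin> H i"
      then have "insert e X \<inter> H i = X \<inter> H i" by auto
      then show False using i Xr by simp
    qed
    then have "insert e X \<inter> H i = insert e (X \<inter> H i)" by auto
    then have "card (insert e X \<inter> H i) = Suc (card (X \<inter> H i))" using eX fX by simp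
    then have "card (X \<inter> H i) = r i" using i(2) Xr[OF i(1)] by linarith
    then show ?thesis using i(1) eH by blast
  qed
  have uniq: "i = j" if i: "i \<in> {1..q}" "card (X \<inter> H i) = r i"
    and j: "j \<in> {1..q}" "card (X \<inter> H j) = r j" for i j
  proof (rule ccontr)
    assume ne: "i \<noteq> j"
    have inter': "int (card (H i \<inter> H j)) \<le> int (r i) + int (r j) - int n"
      using inter i j ne by blast
    have "card ((X \<inter> H i) \<union> (X \<inter> H j)) + card ((X \<inter> H i) \<inter> (X \<inter> H j)) = r i + r j"
      using card_Un_Int[of "X \<inter> H i" "X \<inter> H j"] fX i j by simp
    moreover have "card ((X \<inter> H i) \<union> (X \<inter> H j)) \<le> card X"
      by (rule card_mono[OF fX]) auto
    moreover have "finite (H i \<inter> H j)" using finite_subset[OF H[OF i(1)]] by simp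
    then have "card ((X \<inter> H i) \<inter> (X \<inter> H j)) \<le> card (H i \<inter> H j)"
      by (rule card_mono) auto
    ultimately show False using inter' less by linarith
  qed
  obtain e where "e \<in> Y" using Y(2) by blast
  then obtain i where i: "i \<in> {1..q}" "card (X \<inter> H i) = r i" using tight by blast
  have "Y \<subseteq> H i"
  proof
    fix x assume "x \<in> Y"
    then obtain j where "j \<in> {1..q}" "card (X \<inter> H j) = r j" "x \<in> H j" using tight by blast
    then show "x \<in> H i" using uniq i by blast
  qed
  then show ?thesis using i by blast
qed

lemma is_matroid_elementary_split_matroid:
  fixes n d q :: nat and H :: "nat \<Rightarrow> nat set" and r :: "nat \<Rightarrow> nat"
  assumes H: "\<And>i. i \<in> {1..q} \<Longrightarrow> H i \<subseteq> {1..d}"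
    and inter: "\<And>i j. \<lbrakk>i \<in> {1..q}; j \<in> {1..q}; i \<noteq> j\<rbrakk> \<Longrightarrow>
             int (card (H i \<inter> H j)) \<le> int (r i) + int (r j) - int n"
  shows "is_matroid (elementary_split_matroid n d q H r)" (is "is_matroid ?M")
proof -
  have fin: "finite X" if "X \<in> indeps ?M" for X
    using that by (auto simp: elementary_split_matroid_def intro: finite_subset)
  have down: "Y \<in> indeps ?M" if X: "X \<in> indeps ?M" and YX: "Y \<subseteq> X" for X Y
  proof -
    have "card Y \<le> card X" "\<And>i. card (Y \<inter> H i) \<le> card (X \<inter> H i)"
      using fin[OF X] YX by (auto intro!: card_mono)
    moreover have "X \<subseteq> {1..d}" "card X \<le> n" "\<And>i. i \<in> {1..q} \<Longrightarrow> card (X \<inter> H i) \<le> r i"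
      using X by (simp_all add: elementary_split_matroid_def)
    ultimately have "Y \<subseteq> {1..d}" "card Y \<le> n" "\<And>i. i \<in> {1..q} \<Longrightarrow> card (Y \<inter> H i) \<le> r i"
      using YX by (blast intro: le_trans)+
    then show ?thesis by (simp add: elementary_split_matroid_def)
  qed
  have aug: "\<exists>e\<in>Y - X. insert e X \<in> indeps ?M"
    if X: "X \<in> indeps ?M" and Y: "Y \<in> indeps ?M" and less: "card X < card Y" for X Y
  proof (rule ccontr)
    assume no: "\<not> ?thesis"
    have "card X < n" using Y less by (auto simp: elementary_split_matroid_def)
    moreover have "Y - X \<subseteq> {1..d} - X" using Y by (auto simp: elementary_split_matroid_def)
    moreover have "Y - X \<noteq> {}"
    proof
      assume "Y - X = {}"
      then have "card Y \<le> card X" using fin[OF X] by (intro card_mono) auto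
      then show False using less by simp
    qed
    ultimately obtain i where i: "i \<in> {1..q}" "card (X \<inter> H i) = r i" "Y - X \<subseteq> H i"
      using elementary_split_blocked[OF H inter X, where Y = "Y - X"] no by blast
    have "card (Y \<inter> H i) \<le> r i" using Y i(1) by (auto simp: elementary_split_matroid_def)
    moreover have "card (Y - H i) \<le> card (X - H i)"
      using fin[OF X] i(3) by (auto intro!: card_mono)
    moreover have "card (Y \<inter> H i) + card (Y - H i) = card Y" "card (X \<inter> H i) + card (X - H i) = card X"
      using card_Int_Diff[OF fin[OF Y]] card_Int_Diff[OF fin[OF X]] by simp_all
    ultimately show False using i(2) less by linarith
  qed
  have "finite (ground ?M)" "indeps ?M \<subseteq> Pow (ground ?M)" "{} \<in> indeps ?M"
    by (auto simp: elementary_split_matroid_def)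
  then show ?thesis unfolding is_matroid_def using down aug by blast
qed

lemma matroid_rank_elementary_split_matroid:
  fixes n d q :: nat and H :: "nat \<Rightarrow> nat set" and r :: "nat \<Rightarrow> nat"
  assumes nd: "n \<le> d"
    and H: "\<And>i. i \<in> {1..q} \<Longrightarrow> H i \<subseteq> {1..d}"
    and inter: "\<And>i j. \<lbrakk>i \<in> {1..q}; j \<in> {1..q}; i \<noteq> j\<rbrakk> \<Longrightarrow>
             int (card (H i \<inter> H j)) \<le> int (r i) + int (r j) - int n"
    and co: "\<And>i. i \<in> {1..q} \<Longrightarrow> int (card ({1..d} - H i)) \<ge> int n - int (r i)"
  shows "matroid_rank (elementary_split_matroid n d q H r) = n" (is "matroid_rank ?M = n")
proof -
  let ?C = "card ` {X \<in> indeps ?M. X \<subseteq> ground ?M}"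
  have fC: "finite ?C" and leC: "\<And>k. k \<in> ?C \<Longrightarrow> k \<le> n"
    by (auto simp: elementary_split_matroid_def)
  have "{} \<in> indeps ?M" by (simp add: elementary_split_matroid_def)
  then have neC: "?C \<noteq> {}" by blast
  have "Max ?C \<in> ?C" using fC neC by (rule Max_in)
  then obtain X where X: "X \<in> indeps ?M" "card X = Max ?C" by auto
  have Xd: "X \<subseteq> {1..d}" using X by (auto simp: elementary_split_matroid_def)
  then have fX: "finite X" using finite_subset by blast
  have "\<not> card X < n"
  proof
    assume less: "card X < n"
    have ne: "{1..d} - X \<noteq> {}"
    proof
      assume "{1..d} - X = {}"
      then have "card {1..d} \<le> card X" using fX by (intro card_mono) auto
      then show False using less nd by simp
    qed
    have "insert e X \<notin> indeps ?M" if e: "e \<in> {1..d} - X" for e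
    proof
      assume I: "insert e X \<in> indeps ?M"
      moreover have "insert e X \<subseteq> ground ?M" using e Xd by (auto simp: elementary_split_matroid_def)
      ultimately have "card (insert e X) \<in> ?C" by blast
      then have "card (insert e X) \<le> Max ?C" using fC by simp
      then show False using X(2) e fX by simp
    qed
    then obtain i where i: "i \<in> {1..q}" "card (X \<inter> H i) = r i" "{1..d} - X \<subseteq> H i"
      using elementary_split_blocked[OF H inter X(1) less subset_refl ne] by blast
    have "card ({1..d} - H i) \<le> card (X - H i)" using fX i(3) by (intro card_mono) auto
    moreover have "card (X \<inter> H i) + card (X - H i) = card X"
      using card_Int_Diff[OF fX] by simp
    ultimately show False using co[OF i(1)] i(2) less by linarith
  qed
  moreover have "Max ?C \<le> n" using leC fC neC by simp
  ultimately show ?thesis using X(2) unfolding matroid_rank_def rank_of_def by simp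
qed

end

theory Submission
  imports Defs
begin

text \<open>
  Each \<open>H\<^sub>i\<close> is a flat on which \<open>M\<close> restricts to a uniform matroid of rank \<open>r\<^sub>i\<close>. A dependent
  set \<open>S\<close> of rank less than \<open>n\<close> violates the bound of exactly one \<open>H\<^sub>i\<close>, so that its nullity is
  \<open>c(S) = c(S \<inter> H\<^sub>i)\<close>, while \<open>c(S \<inter> H\<^sub>j) = 0\<close> for the other indices. Hence
  \<open>c(S) = (\<Sum>j. c(S \<inter> H\<^sub>j))\<close> whenever \<open>S\<close> does not span, and for a family of uniform flats this
  identity determines both invariants. Applied to circuits, it shows that the subspaces are the
  \<open>H\<^sub>i\<close>. Since the coefficients \<open>a\<close> of the expected codimension are the Moebius inverse of \<open>c\<close>, it
  also shows by induction that, among nonspanning sets, \<open>a\<close> is supported on the dependent subsets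
  of the \<open>H\<^sub>i\<close>, where it sums to \<open>c(H\<^sub>i)\<close> for each \<open>i\<close>.
\<close>

locale matroid =
  fixes M :: "'a matroid_data"
  assumes is_matroid: "is_matroid M"
begin

lemma finite_ground: "finite (ground M)"
  using is_matroid by (simp add: is_matroid_def)

lemma empty_indep: "{} \<in> indeps M"
  using is_matroid by (simp add: is_matroid_def)

lemma indep_subset_ground: "X \<in> indeps M \<Longrightarrow> X \<subseteq> ground M"
  using is_matroid by (auto simp: is_matroid_def)

lemma indep_subset: "X \<in> indeps M \<Longrightarrow> Y \<subseteq> X \<Longrightarrow> Y \<in> indeps M"
  using is_matroid unfolding is_matroid_def by blast

lemma indep_augment:
  assumes "X \<in> indeps M" "Y \<in> indeps M" "card X < card Y"
  obtains e where "e \<in> Y - X" "insert e X \<in> indeps M"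
proof -
  have "\<forall>X\<in>indeps M. \<forall>Y\<in>indeps M. card X < card Y \<longrightarrow> (\<exists>e\<in>Y - X. insert e X \<in> indeps M)"
    using is_matroid by (simp add: is_matroid_def)
  then show ?thesis using assms that by blast
qed

lemma finite_subset_ground: "S \<subseteq> ground M \<Longrightarrow> finite S"
  using finite_ground finite_subset by blast

lemma finite_indep: "X \<in> indeps M \<Longrightarrow> finite X"
  using finite_subset_ground indep_subset_ground by blast

lemma finite_indep_subsets: "finite {X \<in> indeps M. X \<subseteq> S}"
  using indep_subset_ground finite_ground by (auto intro: finite_subset[of _ "Pow (ground M)"])

lemma card_le_rank_of:
  assumes "X \<in> indeps M" "X \<subseteq> S"
  shows "card X \<le> rank_of M S"
  unfolding rank_of_def using assms finite_indep_subsets by (intro Max_ge) auto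

lemma obtain_basis:
  obtains X where "X \<in> indeps M" "X \<subseteq> S" "card X = rank_of M S"
proof -
  have "rank_of M S \<in> card ` {X \<in> indeps M. X \<subseteq> S}"
    unfolding rank_of_def using finite_indep_subsets empty_indep by (intro Max_in) auto
  then show ?thesis using that by auto
qed

lemma rank_of_mono:
  assumes "S \<subseteq> T"
  shows "rank_of M S \<le> rank_of M T"
proof -
  obtain X where "X \<in> indeps M" "X \<subseteq> S" "card X = rank_of M S" using obtain_basis .
  then show ?thesis using card_le_rank_of[of X T] assms by auto
qed

lemma rank_of_le_card:
  assumes "finite S"
  shows "rank_of M S \<le> card S"
proof -
  obtain X where "X \<subseteq> S" "card X = rank_of M S" using obtain_basis .
  then show ?thesis using card_mono[OF assms] by metis
qed

lemma rank_of_eq_card_iff: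
  assumes "finite S"
  shows "rank_of M S = card S \<longleftrightarrow> S \<in> indeps M"
proof
  assume rank_eq_card: "rank_of M S = card S"
  obtain X where "X \<in> indeps M" "X \<subseteq> S" "card X = rank_of M S" using obtain_basis .
  then show "S \<in> indeps M" using rank_eq_card card_subset_eq[OF assms] by metis
next
  assume "S \<in> indeps M"
  then show "rank_of M S = card S"
    using card_le_rank_of[of S S] rank_of_le_card[OF assms] by simp
qed

lemma rank_of_indep: "X \<in> indeps M \<Longrightarrow> rank_of M X = card X"
  using rank_of_eq_card_iff finite_indep by blast

lemma rank_of_dependent_less:
  assumes "S \<subseteq> ground M" "S \<notin> indeps M"
  shows "rank_of M S < card S"
proof -
  have "finite S" using assms(1) by (rule finite_subset_ground)
  then show ?thesis
    using rank_of_le_card[of S] rank_of_eq_card_iff[of S] assms(2) by linarith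
qed

lemma rank_of_le_matroid_rank: "S \<subseteq> ground M \<Longrightarrow> rank_of M S \<le> matroid_rank M"
  unfolding matroid_rank_def by (rule rank_of_mono)

lemma nullity_nonneg: "finite S \<Longrightarrow> 0 \<le> nullity M S"
  using rank_of_le_card by (simp add: nullity_def)

lemma nullity_eq_0_iff: "finite S \<Longrightarrow> nullity M S = 0 \<longleftrightarrow> S \<in> indeps M"
  using rank_of_eq_card_iff[of S] by (auto simp: nullity_def)

lemma nullity_indep: "X \<in> indeps M \<Longrightarrow> nullity M X = 0"
  by (simp add: nullity_def rank_of_indep)

lemma cl_eq_cl_spanning_subset:
  assumes "S \<subseteq> T" "rank_of M S = rank_of M T"
  shows "cl M S = cl M T"
proof (intro set_eqI iffI)
  fix e assume e: "e \<in> cl M S"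
  have "rank_of M (insert e T) \<le> rank_of M T"
  proof (rule ccontr)
    assume rank_increases: "\<not> ?thesis"
    obtain X where X: "X \<in> indeps M" "X \<subseteq> S" "card X = rank_of M S" using obtain_basis .
    obtain Y where Y: "Y \<in> indeps M" "Y \<subseteq> insert e T" "card Y = rank_of M (insert e T)"
      using obtain_basis .
    obtain f where f: "f \<in> Y - X" "insert f X \<in> indeps M"
      using indep_augment[OF X(1) Y(1)] rank_increases X(3) Y(3) assms(2) by auto
    have card_insert_f: "card (insert f X) = Suc (rank_of M S)"
      using f X finite_indep by simp
    have "f \<notin> T"
      using card_le_rank_of[OF f(2), of T] card_insert_f X(2) assms by auto
    then have "insert f X \<subseteq> insert e S" using f(1) X(2) Y(2) by auto
    then have "Suc (rank_of M S) \<le> rank_of M (insert e S)"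
      using card_le_rank_of[OF f(2)] card_insert_f by metis
    then show False using e by (simp add: cl_def)
  qed
  moreover have "rank_of M T \<le> rank_of M (insert e T)" by (rule rank_of_mono) auto
  ultimately show "e \<in> cl M T" using e by (simp add: cl_def)
next
  fix e assume e: "e \<in> cl M T"
  have "rank_of M (insert e S) \<le> rank_of M (insert e T)"
    using assms(1) by (intro rank_of_mono) auto
  moreover have "rank_of M S \<le> rank_of M (insert e S)" by (rule rank_of_mono) auto
  ultimately show "e \<in> cl M S" using e assms(2) by (simp add: cl_def)
qed

lemma card_circuit:
  assumes "C \<in> circuits M"
  shows "card C = Suc (rank_of M C)"
proof -
  have C: "C \<subseteq> ground M" "C \<notin> indeps M" "\<And>D. D \<subset> C \<Longrightarrow> D \<in> indeps M"
    using assms by (auto simp: circuits_def)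
  obtain x where x: "x \<in> C" using C(2) empty_indep by fastforce
  have "C - {x} \<in> indeps M" using x by (intro C(3)) auto
  then have "card (C - {x}) \<le> rank_of M C" by (rule card_le_rank_of) auto
  moreover have "card C = Suc (card (C - {x}))"
    using card_Suc_Diff1[OF finite_subset_ground[OF C(1)] x] by simp
  ultimately show ?thesis using rank_of_dependent_less[OF C(1,2)] by linarith
qed

definition circuits_in :: "'a set \<Rightarrow> 'a set set" where
  "circuits_in S = {C \<in> circuits M. C \<subseteq> S}"

lemma sum_ec_coeff_subsets:
  assumes "finite S" "S \<in> G"
  shows "(\<Sum>T\<in>{T \<in> G. T \<subseteq> S}. ec_coeff M G T) = nullity M S"
proof (cases "S = {}")
  case True
  then have "{T \<in> G. T \<subseteq> S} = {{}}" using assms(2) by auto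
  then show ?thesis using True by (simp add: ec_coeff.simps nullity_indep empty_indep)
next
  case False
  have "{T \<in> G. T \<subseteq> S} = insert S {T \<in> G. T \<subset> S}" using assms(2) by auto
  moreover have "finite {T \<in> G. T \<subset> S}"
    using assms(1) by (auto intro: finite_subset[of _ "Pow S"])
  moreover have "ec_coeff M G S = nullity M S - (\<Sum>T\<in>{T \<in> G. T \<subset> S}. ec_coeff M G T)"
    using False assms(1) by (subst ec_coeff.simps) simp
  ultimately show ?thesis by simp
qed

lemma ec_coeff_indep:
  assumes "X \<in> indeps M"
  shows "ec_coeff M G X = 0"
  using finite_indep[OF assms] assms
proof (induction X rule: finite_psubset_induct)
  case (psubset X)
  have "ec_coeff M G T = 0" if "T \<subset> X" for T
    using psubset.IH[OF that] indep_subset[OF psubset.prems] that by blast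
  then have "(\<Sum>T\<in>{T \<in> G. T \<subset> X}. ec_coeff M G T) = 0" by simp
  then show ?case using nullity_indep[OF psubset.prems] by (subst ec_coeff.simps) simp
qed

definition dependent_subsets :: "'a set \<Rightarrow> 'a set set" where
  "dependent_subsets S = {T. T \<subseteq> S \<and> T \<notin> indeps M}"

lemma finite_dependent_subsets: "S \<subseteq> ground M \<Longrightarrow> finite (dependent_subsets S)"
  using finite_subset_ground
  by (auto simp: dependent_subsets_def intro: finite_subset[of _ "Pow S"])

lemma sum_ec_coeff_dependent_subsets:
  assumes "S \<subseteq> ground M"
  shows "(\<Sum>T\<in>dependent_subsets S. ec_coeff M (Pow (ground M)) T) = nullity M S"
proof -
  have "(\<Sum>T\<in>dependent_subsets S. ec_coeff M (Pow (ground M)) T)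
      = (\<Sum>T\<in>{T \<in> Pow (ground M). T \<subseteq> S}. ec_coeff M (Pow (ground M)) T)"
    using assms finite_ground ec_coeff_indep
    by (intro sum.mono_neutral_left) (auto simp: dependent_subsets_def)
  also have "\<dots> = nullity M S"
    using assms finite_subset_ground by (intro sum_ec_coeff_subsets) auto
  finally show ?thesis .
qed

end

locale nullity_decomposition = matroid M for M :: "'a matroid_data" +
  fixes \<F> :: "'a set set"
  assumes cl_member: "F \<in> \<F> \<Longrightarrow> cl M F = F"
    and member_dependent: "F \<in> \<F> \<Longrightarrow> F \<notin> indeps M"
    and rank_of_member_less: "F \<in> \<F> \<Longrightarrow> rank_of M F < matroid_rank M"
    and rank_of_dependent_subset:
      "F \<in> \<F> \<Longrightarrow> S \<subseteq> F \<Longrightarrow> S \<notin> indeps M \<Longrightarrow> rank_of M S = rank_of M F"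
    and nullity_eq_sum:
      "S \<subseteq> ground M \<Longrightarrow> rank_of M S < matroid_rank M \<Longrightarrow>
        nullity M S = (\<Sum>F\<in>\<F>. nullity M (S \<inter> F))"
begin

lemma member_subset_ground: "F \<in> \<F> \<Longrightarrow> F \<subseteq> ground M"
  using cl_member by (auto simp: cl_def)

lemma finite_member: "F \<in> \<F> \<Longrightarrow> finite F"
  using member_subset_ground finite_subset_ground by blast

lemma finite_family: "finite \<F>"
  using member_subset_ground finite_ground by (auto intro: finite_subset[of _ "Pow (ground M)"])

lemma member_Int_indep:
  assumes "F \<in> \<F>" "G \<in> \<F>" "F \<noteq> G"
  shows "F \<inter> G \<in> indeps M"
proof -
  have "nullity M F = nullity M F + (\<Sum>G\<in>\<F> - {F}. nullity M (F \<inter> G))"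
    using nullity_eq_sum[OF member_subset_ground rank_of_member_less] assms(1) finite_family
    by (simp add: sum.remove)
  then have "\<forall>G\<in>\<F> - {F}. nullity M (F \<inter> G) = 0"
    using finite_family finite_member[OF assms(1)] nullity_nonneg
    by (subst sum_nonneg_eq_0_iff[symmetric]) auto
  then show ?thesis using assms finite_member nullity_eq_0_iff by auto
qed

lemma dependent_subset_member_unique:
  assumes "F \<in> \<F>" "G \<in> \<F>" "S \<subseteq> F" "S \<subseteq> G" "S \<notin> indeps M"
  shows "F = G"
  using member_Int_indep[OF assms(1,2)] indep_subset[of "F \<inter> G" S] assms(3-5) by auto

lemma indep_subset_member_iff:
  assumes "F \<in> \<F>" "S \<subseteq> F"
  shows "S \<in> indeps M \<longleftrightarrow> card S \<le> rank_of M F"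
proof
  assume "S \<in> indeps M"
  then show "card S \<le> rank_of M F" using assms(2) by (rule card_le_rank_of)
next
  assume card_le: "card S \<le> rank_of M F"
  show "S \<in> indeps M"
  proof (rule ccontr)
    assume dependent: "S \<notin> indeps M"
    moreover have "S \<subseteq> ground M" using assms member_subset_ground by blast
    ultimately have "rank_of M S < card S" by (intro rank_of_dependent_less)
    then show False using rank_of_dependent_subset[OF assms dependent] card_le by simp
  qed
qed

subsection \<open>Naive dimension\<close>

lemma rank_of_circuit_in:
  assumes "F \<in> \<F>" "C \<in> circuits_in F"
  shows "rank_of M C = rank_of M F"
  using assms rank_of_dependent_subset by (auto simp: circuits_in_def circuits_def)

lemma circuits_in_member:
  assumes "F \<in> \<F>"
  shows "circuits_in F = {C. C \<subseteq> F \<and> card C = Suc (rank_of M F)}"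
proof (intro set_eqI iffI)
  fix C assume "C \<in> circuits_in F"
  then show "C \<in> {C. C \<subseteq> F \<and> card C = Suc (rank_of M F)}"
    using card_circuit rank_of_circuit_in[OF assms] by (auto simp: circuits_in_def)
next
  fix C assume C: "C \<in> {C. C \<subseteq> F \<and> card C = Suc (rank_of M F)}"
  have "D \<in> indeps M" if "D \<subset> C" for D
    using psubset_card_mono[OF _ that] indep_subset_member_iff[OF assms, of D] C that
      finite_subset[OF _ finite_member[OF assms]] by auto
  then show "C \<in> circuits_in F"
    using C indep_subset_member_iff[OF assms, of C] member_subset_ground[OF assms]
    by (auto simp: circuits_in_def circuits_def)
qed

lemma Union_circuits_in:
  assumes "F \<in> \<F>"
  shows "\<Union>(circuits_in F) = F"
proof
  show "F \<subseteq> \<Union>(circuits_in F)"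
  proof
    fix x assume x: "x \<in> F"
    have "rank_of M F \<le> card (F - {x})"
      using rank_of_dependent_less[OF member_subset_ground member_dependent] x assms
        finite_member by fastforce
    then obtain B where B: "B \<subseteq> F - {x}" "card B = rank_of M F" "finite B"
      using obtain_subset_with_card_n by metis
    then have "insert x B \<subseteq> F" "card (insert x B) = Suc (rank_of M F)"
      using x by (auto simp: card_insert_if)
    then show "x \<in> \<Union>(circuits_in F)" using circuits_in_member[OF assms] by blast
  qed
qed (auto simp: circuits_in_def)

lemma circuits_in_nonempty:
  assumes "F \<in> \<F>"
  shows "circuits_in F \<noteq> {}"
  using Union_circuits_in[OF assms] member_dependent[OF assms] empty_indep by auto

lemma small_circuits_eq: "small_circuits M = (\<Union>F\<in>\<F>. circuits_in F)"
proof (intro set_eqI iffI)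
  fix C assume "C \<in> small_circuits M"
  then have C: "C \<in> circuits M" "C \<subseteq> ground M" "card C \<le> matroid_rank M"
    by (auto simp: small_circuits_def circuits_def)
  have "(\<Sum>F\<in>\<F>. nullity M (C \<inter> F)) = 1"
    using nullity_eq_sum[OF C(2)] card_circuit[OF C(1)] C(3) by (simp add: nullity_def)
  then obtain F where F: "F \<in> \<F>" "nullity M (C \<inter> F) \<noteq> 0"
    by (metis sum.neutral zero_neq_one)
  then have "C \<inter> F \<notin> indeps M" using nullity_indep by blast
  then have "C \<inter> F = C" using C(1) by (auto simp: circuits_def)
  then show "C \<in> (\<Union>F\<in>\<F>. circuits_in F)" using C(1) F(1) by (auto simp: circuits_in_def)
next
  fix C assume "C \<in> (\<Union>F\<in>\<F>. circuits_in F)"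
  then obtain F where F: "F \<in> \<F>" "C \<in> circuits_in F" by blast
  then show "C \<in> small_circuits M"
    using card_circuit[of C] rank_of_circuit_in[OF F] rank_of_member_less[OF F(1)]
    by (auto simp: circuits_in_def small_circuits_def)
qed

lemma cl_circuit_in:
  assumes "F \<in> \<F>" "C \<in> circuits_in F"
  shows "cl M C = F"
proof -
  have "C \<subseteq> F" using assms(2) by (simp add: circuits_in_def)
  then have "cl M C = cl M F"
    using rank_of_circuit_in[OF assms] by (rule cl_eq_cl_spanning_subset)
  then show ?thesis using cl_member[OF assms(1)] by simp
qed

lemma circuit_class:
  assumes "F \<in> \<F>" "C \<in> circuits_in F"
  shows "circuit_rel M `` {C} = circuits_in F"
proof (intro set_eqI iffI)
  fix D assume "D \<in> circuit_rel M `` {C}"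
  then obtain G where G: "G \<in> \<F>" "D \<in> circuits_in G" and same_cl: "cl M C = cl M D"
    unfolding circuit_rel_def small_circuits_eq by blast
  have "F = G" using same_cl cl_circuit_in[OF assms] cl_circuit_in[OF G] by simp
  then show "D \<in> circuits_in F" using G(2) by simp
next
  fix D assume D: "D \<in> circuits_in F"
  then have "cl M C = cl M D" using cl_circuit_in assms by simp
  then show "D \<in> circuit_rel M `` {C}"
    unfolding circuit_rel_def small_circuits_eq using assms D by blast
qed

lemma subspaces_eq: "subspaces M = circuits_in ` \<F>"
proof -
  have "subspaces M = (\<Union>F\<in>\<F>. \<Union>C\<in>circuits_in F. {circuits_in F})"
    unfolding subspaces_def quotient_def small_circuits_eq using circuit_class by auto
  also have "\<dots> = circuits_in ` \<F>" using circuits_in_nonempty by auto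
  finally show ?thesis .
qed

lemma subspace_rank_circuits_in:
  assumes "F \<in> \<F>"
  shows "subspace_rank M (circuits_in F) = rank_of M F"
  unfolding subspace_rank_def
  using circuits_in_nonempty[OF assms] rank_of_circuit_in[OF assms] by (intro the_equality) auto

theorem naive_dim_eq:
  "naive_dim M = int (matroid_rank M) * int (card (ground M))
    - (\<Sum>F\<in>\<F>. (int (matroid_rank M) - int (rank_of M F)) * nullity M F)"
proof -
  have "inj_on circuits_in \<F>" by (rule inj_onI) (metis Union_circuits_in)
  then show ?thesis
    by (simp add: naive_dim_def subspaces_eq sum.reindex subspace_points_def Union_circuits_in
        subspace_rank_circuits_in nullity_def mult.commute)
qed

subsection \<open>Expected codimension\<close>

lemma sum_UN_dependent_subsets:
  fixes f :: "'a set \<Rightarrow> int"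
  shows "(\<Sum>T\<in>(\<Union>F\<in>\<F>. dependent_subsets (S \<inter> F)). f T)
    = (\<Sum>F\<in>\<F>. \<Sum>T\<in>dependent_subsets (S \<inter> F). f T)"
proof (rule sum.UNION_disjoint)
  show "\<forall>F\<in>\<F>. finite (dependent_subsets (S \<inter> F))"
    using member_subset_ground finite_dependent_subsets by (metis le_infI2)
  show "\<forall>F\<in>\<F>. \<forall>G\<in>\<F>. F \<noteq> G \<longrightarrow> dependent_subsets (S \<inter> F) \<inter> dependent_subsets (S \<inter> G) = {}"
    using dependent_subset_member_unique by (auto simp: dependent_subsets_def)
qed (rule finite_family)

lemma sum_ec_coeff_UN_dependent_subsets:
  assumes "S \<subseteq> ground M" "rank_of M S < matroid_rank M"
  shows "(\<Sum>T\<in>(\<Union>F\<in>\<F>. dependent_subsets (S \<inter> F)). ec_coeff M (Pow (ground M)) T)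
    = nullity M S"
proof -
  have "(\<Sum>T\<in>dependent_subsets (S \<inter> F). ec_coeff M (Pow (ground M)) T) = nullity M (S \<inter> F)" for F
    using assms(1) by (intro sum_ec_coeff_dependent_subsets) auto
  then show ?thesis by (simp add: sum_UN_dependent_subsets nullity_eq_sum[OF assms])
qed

lemma ec_coeff_nonspanning_eq_0:
  assumes "S \<subseteq> ground M" "rank_of M S < matroid_rank M" "S \<notin> (\<Union>F\<in>\<F>. dependent_subsets F)"
  shows "ec_coeff M (Pow (ground M)) S = 0"
  using finite_subset_ground[OF assms(1)] assms
proof (induction S rule: finite_psubset_induct)
  case (psubset S)
  let ?a = "ec_coeff M (Pow (ground M))"
  show ?case
  proof (cases "S \<in> indeps M")
    case True
    then show ?thesis by (rule ec_coeff_indep)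
  next
    case False
    let ?D = "\<Union>F\<in>\<F>. dependent_subsets (S \<inter> F)"
    have proper: "?D \<subseteq> dependent_subsets S - {S}"
      using psubset.prems(3) by (auto simp: dependent_subsets_def)
    have "?a T = 0" if T: "T \<in> dependent_subsets S - {S} - ?D" for T
    proof (rule psubset.IH)
      show "T \<subset> S" using T by (auto simp: dependent_subsets_def)
      then show "rank_of M T < matroid_rank M" "T \<subseteq> ground M"
        using rank_of_mono[of T S] psubset.prems(1,2) by auto
      show "T \<notin> (\<Union>F\<in>\<F>. dependent_subsets F)" using T by (auto simp: dependent_subsets_def)
    qed
    then have "(\<Sum>T\<in>dependent_subsets S - {S}. ?a T) = (\<Sum>T\<in>?D. ?a T)"
      using proper finite_dependent_subsets[OF psubset.prems(1)]
      by (intro sum.mono_neutral_right) auto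
    also have "\<dots> = nullity M S"
      using psubset.prems by (intro sum_ec_coeff_UN_dependent_subsets)
    also have "\<dots> = (\<Sum>T\<in>dependent_subsets S. ?a T)"
      using sum_ec_coeff_dependent_subsets[OF psubset.prems(1)] by simp
    also have "\<dots> = ?a S + (\<Sum>T\<in>dependent_subsets S - {S}. ?a T)"
      using finite_dependent_subsets[OF psubset.prems(1)] False
      by (intro sum.remove) (auto simp: dependent_subsets_def)
    finally show ?thesis by simp
  qed
qed

theorem expected_codim_eq:
  "expected_codim M = (\<Sum>F\<in>\<F>. (int (matroid_rank M) - int (rank_of M F)) * nullity M F)"
proof -
  let ?a = "ec_coeff M (Pow (ground M))"
  let ?corank = "\<lambda>S. int (matroid_rank M) - int (rank_of M S)"
  have vanish: "?corank S * ?a S = 0"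
    if "S \<in> Pow (ground M) - (\<Union>F\<in>\<F>. dependent_subsets F)" for S
    using that rank_of_le_matroid_rank[of S] ec_coeff_nonspanning_eq_0[of S] by fastforce
  have dependent_subsets_ground: "(\<Union>F\<in>\<F>. dependent_subsets F) \<subseteq> Pow (ground M)"
    using member_subset_ground unfolding dependent_subsets_def by blast
  have "expected_codim M = (\<Sum>S\<in>Pow (ground M). ?corank S * ?a S)"
    by (simp add: expected_codim_def expected_codim_wrt_def)
  also have "\<dots> = (\<Sum>S\<in>(\<Union>F\<in>\<F>. dependent_subsets F). ?corank S * ?a S)"
    using finite_ground dependent_subsets_ground vanish by (intro sum.mono_neutral_right) auto
  also have "\<dots> = (\<Sum>F\<in>\<F>. \<Sum>S\<in>dependent_subsets F. ?corank S * ?a S)"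
    using sum_UN_dependent_subsets[where S = UNIV] by simp
  also have "\<dots> = (\<Sum>F\<in>\<F>. ?corank F * (\<Sum>S\<in>dependent_subsets F. ?a S))"
    unfolding sum_distrib_left
    by (intro sum.cong refl) (auto simp: dependent_subsets_def rank_of_dependent_subset)
  also have "\<dots> = (\<Sum>F\<in>\<F>. ?corank F * nullity M F)"
    by (simp add: sum_ec_coeff_dependent_subsets member_subset_ground)
  finally show ?thesis .
qed

end

subsection \<open>Elementary split matroids\<close>

locale elementary_split =
  fixes n d q :: nat and H :: "nat \<Rightarrow> nat set" and r :: "nat \<Rightarrow> nat"
    and M :: "nat matroid_data"
  assumes M_eq: "M = elementary_split_matroid n d q H r"
    and n_le_d: "n \<le> d"
    and H_subset: "\<And>i. i \<in> {1..q} \<Longrightarrow> H i \<subseteq> {1..d}"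
    and card_H_Int: "\<And>i j. \<lbrakk>i \<in> {1..q}; j \<in> {1..q}; i \<noteq> j\<rbrakk> \<Longrightarrow>
           int (card (H i \<inter> H j)) \<le> int (r i) + int (r j) - int n"
    and card_compl_H: "\<And>i. i \<in> {1..q} \<Longrightarrow> int (card ({1..d} - H i)) \<ge> int n - int (r i)"
    and r_less: "\<And>i. i \<in> {1..q} \<Longrightarrow> r i < n"
    and r_less_card_H: "\<And>i. i \<in> {1..q} \<Longrightarrow> r i < card (H i)"
begin

sublocale matroid M
  using is_matroid_elementary_split_matroid[of q H d r n, OF H_subset card_H_Int] M_eq
  by unfold_locales simp

lemma ground_M: "ground M = {1..d}"
  by (simp add: M_eq elementary_split_matroid_def)

lemma indep_iff:
  "X \<in> indeps M \<longleftrightarrow> X \<subseteq> {1..d} \<and> card X \<le> n \<and> (\<forall>i\<in>{1..q}. card (X \<inter> H i) \<le> r i)"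
  by (simp add: M_eq elementary_split_matroid_def)

lemma matroid_rank_M: "matroid_rank M = n"
  unfolding M_eq using n_le_d H_subset card_H_Int card_compl_H
  by (rule matroid_rank_elementary_split_matroid)

lemma card_H_Int_less:
  assumes "i \<in> {1..q}" "j \<in> {1..q}" "i \<noteq> j"
  shows "card (H i \<inter> H j) < r j"
  using card_H_Int[OF assms] r_less[OF assms(1)] by linarith

lemma inj_on_H: "inj_on H {1..q}"
proof (rule inj_onI, rule ccontr)
  fix i j assume ij: "i \<in> {1..q}" "j \<in> {1..q}" "H i = H j" "i \<noteq> j"
  then show False using card_H_Int_less[OF ij(1,2,4)] r_less_card_H[OF ij(2)] by simp
qed

lemma indep_subset_H_iff:
  assumes i: "i \<in> {1..q}" and T: "T \<subseteq> H i"
  shows "T \<in> indeps M \<longleftrightarrow> card T \<le> r i"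
proof
  assume "T \<in> indeps M"
  then have "card (T \<inter> H i) \<le> r i" using i by (auto simp only: indep_iff)
  then show "card T \<le> r i" using T by (simp add: Int_absorb2)
next
  assume card_le: "card T \<le> r i"
  have "card (T \<inter> H j) \<le> r j" if j: "j \<in> {1..q}" for j
  proof (cases "i = j")
    case True
    then show ?thesis using T card_le by (simp add: Int_absorb2)
  next
    case False
    have "finite (H i \<inter> H j)" using H_subset[OF i] finite_subset by blast
    then have "card (T \<inter> H j) \<le> card (H i \<inter> H j)" using T by (intro card_mono) auto
    then show ?thesis using card_H_Int_less[OF i j False] by linarith
  qed
  then show "T \<in> indeps M" using T card_le r_less[OF i] H_subset[OF i] by (auto simp: indep_iff)
qed

lemma rank_of_subset_H:
  assumes i: "i \<in> {1..q}" and T: "T \<subseteq> H i" "r i \<le> card T"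
  shows "rank_of M T = r i"
proof (rule antisym)
  obtain X where "X \<in> indeps M" "X \<subseteq> T" "card X = rank_of M T" using obtain_basis .
  then show "rank_of M T \<le> r i" using indep_subset_H_iff[OF i, of X] T by auto
next
  obtain X where "X \<subseteq> T" "card X = r i" using T(2) obtain_subset_with_card_n by metis
  then show "r i \<le> rank_of M T"
    using card_le_rank_of[of X T] indep_subset_H_iff[OF i, of X] T by auto
qed

lemma rank_of_nonspanning_dependent:
  assumes S: "S \<subseteq> {1..d}" "S \<notin> indeps M" and nonspanning: "rank_of M S < n"
  obtains i where "i \<in> {1..q}" "rank_of M S = card (S - H i) + r i" "r i < card (S \<inter> H i)"
proof -
  obtain X where X: "X \<in> indeps M" "X \<subseteq> S" "card X = rank_of M S" using obtain_basis .
  have blocked: "insert e X \<notin> indeps M" if "e \<in> S - X" for e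
    using that card_le_rank_of[of "insert e X" S] X finite_indep by auto
  have nonempty: "S - X \<noteq> {}" using X S by auto
  have "\<exists>i\<in>{1..q}. card (X \<inter> H i) = r i \<and> S - X \<subseteq> H i"
    using elementary_split_blocked[of q H d r n X "S - X", OF H_subset card_H_Int]
      X nonspanning S(1) nonempty blocked M_eq by auto
  then obtain i where i: "i \<in> {1..q}" "card (X \<inter> H i) = r i" "S - X \<subseteq> H i" by blast
  have "X - H i = S - H i" using i(3) X(2) by auto
  then have "rank_of M S = card (S - H i) + r i"
    using card_Int_Diff[OF finite_indep[OF X(1)], of "H i"] i(2) X(3) by simp
  moreover have "card (X \<inter> H i) < card (S \<inter> H i)"
    using i(3) X(2) nonempty finite_subset[OF S(1)] by (intro psubset_card_mono) auto
  ultimately show ?thesis using that i(1,2) by simp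
qed

lemma card_Int_other_H_less:
  assumes S: "S \<subseteq> {1..d}" and ij: "i \<in> {1..q}" "j \<in> {1..q}" "i \<noteq> j"
    and violated_rank_less: "card (S - H i) + r i < n"
  shows "card (S \<inter> H j) < r j"
proof -
  have "finite S" "finite (H i)"
    using S H_subset[OF ij(1)] finite_subset_ground ground_M by auto
  then have "card (S \<inter> H j) \<le> card ((S - H i) \<union> (H i \<inter> H j))"
    by (intro card_mono) auto
  also have "\<dots> \<le> card (S - H i) + card (H i \<inter> H j)" by (rule card_Un_le)
  finally show ?thesis using card_H_Int[OF ij] violated_rank_less by linarith
qed

lemma nullity_eq_sum_H:
  assumes S: "S \<subseteq> {1..d}" and nonspanning: "rank_of M S < n"
  shows "nullity M S = (\<Sum>F\<in>H ` {1..q}. nullity M (S \<inter> F))"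
proof (cases "S \<in> indeps M")
  case True
  then show ?thesis using nullity_indep indep_subset by (simp add: sum.neutral)
next
  case False
  obtain i where i: "i \<in> {1..q}" and rank: "rank_of M S = card (S - H i) + r i"
    and violated: "r i < card (S \<inter> H i)"
    using rank_of_nonspanning_dependent[OF S False nonspanning] .
  have "nullity M (S \<inter> F) = 0" if F: "F \<in> H ` {1..q} - {H i}" for F
  proof -
    obtain j where j: "j \<in> {1..q}" "F = H j" using F by blast
    moreover have "i \<noteq> j" using F j(2) by auto
    ultimately have "card (S \<inter> H j) < r j"
      using card_Int_other_H_less[OF S i] rank nonspanning by simp
    then show ?thesis using indep_subset_H_iff[of j "S \<inter> H j"] nullity_indep j by simp
  qed
  then have "(\<Sum>F\<in>H ` {1..q}. nullity M (S \<inter> F)) = (\<Sum>F\<in>{H i}. nullity M (S \<inter> F))"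
    using i by (intro sum.mono_neutral_right) auto
  moreover have "nullity M (S \<inter> H i) = nullity M S"
    using rank_of_subset_H[OF i, of "S \<inter> H i"] violated rank
      card_Int_Diff[OF finite_subset[OF S], of "H i"] by (simp add: nullity_def)
  ultimately show ?thesis by simp
qed

lemma rank_of_H: "i \<in> {1..q} \<Longrightarrow> rank_of M (H i) = r i"
  using rank_of_subset_H r_less_card_H by (simp add: less_imp_le)

lemma H_dependent:
  assumes i: "i \<in> {1..q}"
  shows "H i \<notin> indeps M"
  using indep_subset_H_iff[OF i subset_refl] r_less_card_H[OF i] by simp

lemma cl_H:
  assumes i: "i \<in> {1..q}"
  shows "cl M (H i) = H i"
proof -
  have "rank_of M (insert e (H i)) \<noteq> r i" if e: "e \<in> {1..d} - H i" for e
  proof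
    assume rank: "rank_of M (insert e (H i)) = r i"
    have insert_subset: "insert e (H i) \<subseteq> {1..d}" using e H_subset[OF i] by auto
    have "insert e (H i) \<notin> indeps M" using H_dependent[OF i] indep_subset by blast
    then obtain j where j: "j \<in> {1..q}" and rank_formula: "r i = card (insert e (H i) - H j) + r j"
      using rank_of_nonspanning_dependent[OF insert_subset] rank r_less[OF i] by metis
    have "j = i"
    proof (rule ccontr)
      assume "j \<noteq> i"
      then have "card (insert e (H i) \<inter> H i) < r i"
        using card_Int_other_H_less[OF insert_subset j i] rank_formula r_less[OF i] by simp
      moreover have "insert e (H i) \<inter> H i = H i" by auto
      ultimately show False using r_less_card_H[OF i] by simp
    qed
    moreover have "insert e (H i) - H i = {e}" using e by auto
    ultimately show False using rank_formula by simp
  qed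
  then show ?thesis
    using H_subset[OF i] rank_of_H[OF i] by (auto simp: cl_def ground_M insert_absorb)
qed

sublocale nullity_decomposition M "H ` {1..q}"
proof unfold_locales
  fix F S assume F: "F \<in> H ` {1..q}" and S: "S \<subseteq> F" "S \<notin> indeps M"
  then obtain i where "i \<in> {1..q}" "F = H i" by blast
  then show "rank_of M S = rank_of M F"
    using S indep_subset_H_iff[of i S] rank_of_subset_H[of i S] rank_of_H[of i] by simp
qed (use cl_H H_dependent rank_of_H r_less nullity_eq_sum_H
  in \<open>auto simp: matroid_rank_M ground_M\<close>)

lemma sum_corank_nullity_H:
  "(\<Sum>F\<in>H ` {1..q}. (int (matroid_rank M) - int (rank_of M F)) * nullity M F)
    = (\<Sum>i=1..q. (int n - int (r i)) * (int (card (H i)) - int (r i)))"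
  unfolding sum.reindex[OF inj_on_H]
  by (intro sum.cong refl) (simp add: matroid_rank_M nullity_def rank_of_H)

end

theorem theorem3p11:
  fixes n d q :: nat and H :: "nat \<Rightarrow> nat set" and r :: "nat \<Rightarrow> nat"
    and M :: "nat matroid_data"
  assumes "0 < n" and "n \<le> d"
    and "\<And>i. i \<in> {1..q} \<Longrightarrow> H i \<subseteq> {1..d}"
    and "\<And>i. i \<in> {1..q} \<Longrightarrow> 0 < r i"
    and "\<And>i j. \<lbrakk>i \<in> {1..q}; j \<in> {1..q}; i \<noteq> j\<rbrakk> \<Longrightarrow>
           int (card (H i \<inter> H j)) \<le> int (r i) + int (r j) - int n"
    and "\<And>i. i \<in> {1..q} \<Longrightarrow> int (card ({1..d} - H i)) \<ge> int n - int (r i)"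
    and "\<And>i. i \<in> {1..q} \<Longrightarrow> int (r i) \<le> int n - 1"
    and "\<And>i. i \<in> {1..q} \<Longrightarrow> card (H i) \<ge> r i + 1"
    and "M = elementary_split_matroid n d q H r"
  shows "naive_dim M = int n * int d - expected_codim M \<and>
         int n * int d - expected_codim M =
           int n * int d - (\<Sum>i=1..q. (int n - int (r i)) * (int (card (H i)) - int (r i)))"
proof -
  interpret elementary_split n d q H r M
    using assms by unfold_locales fastforce+
  show ?thesis
    unfolding naive_dim_eq expected_codim_eq sum_corank_nullity_H
    by (simp add: matroid_rank_M ground_M)
qed

end
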